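(* Let $\{x_i\}_{i=1}^m$ be a frame for $\mathbb{R}^n$, let $P:\mathbb{R}^n\to\mathbb{R}^n$ be an orthogonal projection, and let $\{a_i,b_i\}_{i=1}^m$ be real constants. Then $\{x_i\}_{i=1}^m$ is piecewise scalable with the projection $P$ and scaling constants $\{a_i,b_i\}_{i=1}^m$ if and only if $\{a_iPx_i\}_{i=1}^m$ and $\{b_i(I-P)x_i\}_{i=1}^m$ are Parseval frames for the range of $P$ and the range of $I-P$, respectively, and the rows of the matrix $[a_iPx_i]_{i=1}^m$ are orthogonal to the rows of the matrix $[b_i(I-P)x_i]_{i=1}^m$ (every row of the first is orthogonal in $\mathbb{R}^m$ to every row of the second).
   Context: For vectors $v_1,\dots,v_m\in\mathbb{R}^n$, $[v_i]_{i=1}^m$ denotes the $n\times m$ matrix whose columns are $v_1,\dots,v_m$ (in canonical coordinates). A finite family $\{x_i\}_{i=1}^m$ in a finite-dimensional real inner product space $H$ is a frame for $H$ if there are constants $0<A\le B<\infty$ with $A\|x\|^2\le\sum_{i=1}^m|\langle x,x_i\rangle|^2\le B\|x\|^2$ for all $x\in H$; it is a Parseval frame for $H$ if $\sum_{i=1}^m|\langle x,x_i\rangle|^2=\|x\|^2$ for all $x\in H$. An orthogonal projection is a linear map $P$ with $P\circ P=P$ and $P^*=P$; $I$ is the identity. A frame $\{x_i\}_{i=1}^m$ for $\mathbb{R}^n$ is piecewise scalable with an orthogonal projection $P$ and scaling constants $\{a_i,b_i\}_{i=1}^m\subset\mathbb{R}$ if $\{a_iPx_i+b_i(I-P)x_i\}_{i=1}^m$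 is a Parseval frame for $\mathbb{R}^n$. *)

theory Defs
  imports "HOL-Analysis.Analysis"
begin

text \<open>
  Families are indexed by a finite type. The space \<open>H\<close> is a linear subspace of an ambient inner
  product space, with the induced inner product, and the members of the family have to lie in it.
\<close>

definition frame_for :: "'a::real_inner set \<Rightarrow> ('i::finite \<Rightarrow> 'a) \<Rightarrow> bool" where
  "frame_for H x \<longleftrightarrow> subspace H \<and> range x \<subseteq> H \<and>
     (\<exists>A B. 0 < A \<and> A \<le> B \<and>
       (\<forall>v\<in>H. A * (norm v)\<^sup>2 \<le> (\<Sum>i\<in>UNIV. \<bar>v \<bullet> x i\<bar>\<^sup>2) \<and>
              (\<Sum>i\<in>UNIV. \<bar>v \<bullet> x i\<bar>\<^sup>2) \<le> B * (norm v)\<^sup>2))"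

definition parseval_frame_for :: "'a::real_inner set \<Rightarrow> ('i::finite \<Rightarrow> 'a) \<Rightarrow> bool" where
  "parseval_frame_for H x \<longleftrightarrow> subspace H \<and> range x \<subseteq> H \<and>
     (\<forall>v\<in>H. (\<Sum>i\<in>UNIV. \<bar>v \<bullet> x i\<bar>\<^sup>2) = (norm v)\<^sup>2)"

definition orthogonal_projection :: "('a::euclidean_space \<Rightarrow> 'a) \<Rightarrow> bool" where
  "orthogonal_projection P \<longleftrightarrow> linear P \<and> P \<circ> P = P \<and> adjoint P = P"

definition piecewise_scalable_with ::
  "('i::finite \<Rightarrow> 'a::euclidean_space) \<Rightarrow> ('a \<Rightarrow> 'a) \<Rightarrow> ('i \<Rightarrow> real) \<Rightarrow> ('i \<Rightarrow> real) \<Rightarrow> bool" where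
  "piecewise_scalable_with x P a b \<longleftrightarrow>
     frame_for UNIV x \<and> orthogonal_projection P \<and>
     parseval_frame_for UNIV (\<lambda>i. a i *\<^sub>R P (x i) + b i *\<^sub>R (x i - P (x i)))"

definition matrix_of_columns :: "('m::finite \<Rightarrow> real ^ 'n::finite) \<Rightarrow> real ^ 'm ^ 'n" where
  "matrix_of_columns v = (\<chi> k i. v i $ k)"

end

theory Submission
  imports Defs
begin

text \<open>
  For \<open>v = u + w\<close> with \<open>u\<close> in the range of \<open>P\<close> and \<open>w\<close> in the range of \<open>I - P\<close>, the sum of squared
  coefficients of \<open>v\<close> with respect to \<open>{p\<^sub>i + q\<^sub>i}\<close>, where \<open>p\<^sub>i = a\<^sub>i P x\<^sub>i\<close> and
  \<open>q\<^sub>i = b\<^sub>i (I - P) x\<^sub>i\<close>, is that of \<open>u\<close> with respect to \<open>{p\<^sub>i}\<close> plus that of \<open>w\<close> with respect to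
  \<open>{q\<^sub>i}\<close> plus \<open>2 \<Sum> (u \<bullet> p\<^sub>i) (w \<bullet> q\<^sub>i)\<close>. Comparing with \<open>\<parallel>v\<parallel>\<^sup>2 = \<parallel>u\<parallel>\<^sup>2 + \<parallel>w\<parallel>\<^sup>2\<close>, taking \<open>w = 0\<close>
  and \<open>u = 0\<close> gives the two Parseval identities, and then the bilinear cross term vanishes. On the
  canonical basis this cross term is the inner product of rows of the two matrices.
\<close>

lemma orthogonal_projection_inner:
  assumes "orthogonal_projection P"
  shows "P v \<bullet> w = v \<bullet> P w"
  using assms adjoint_works[of P w v] by (simp add: orthogonal_projection_def inner_commute)

lemma orthogonal_projection_idem:
  assumes "orthogonal_projection P"
  shows "P (P v) = P v"
  using assms by (metis comp_apply orthogonal_projection_def)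

text \<open>Self-adjointness and idempotence give
  \<open>P v \<bullet> w = P (P v) \<bullet> w = P v \<bullet> P w\<close>.\<close>

lemma orthogonal_projection_inner_complement:
  assumes "orthogonal_projection P"
  shows "P v \<bullet> (w - P w) = 0"
  using orthogonal_projection_inner[OF assms, of "P v" w] orthogonal_projection_idem[OF assms, of v]
  by (simp add: inner_diff_right)

text \<open>The cross-term condition runs over all vectors, not just over \<open>H\<close> and
  \<open>K\<close>, so that canonical basis vectors, which may lie in neither subspace, can be
  inserted.\<close>

lemma parseval_frame_for_orthogonal_sum_iff:
  fixes p q :: "'i::finite \<Rightarrow> 'a::real_inner"
  assumes H: "subspace H" and K: "subspace K"
    and orth: "\<And>u w. u \<in> H \<Longrightarrow> w \<in> K \<Longrightarrow> u \<bullet> w = 0"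
    and decomp: "\<And>v. \<exists>u\<in>H. \<exists>w\<in>K. v = u + w"
    and p: "range p \<subseteq> H" and q: "range q \<subseteq> K"
  shows "parseval_frame_for UNIV (\<lambda>i. p i + q i) \<longleftrightarrow>
    parseval_frame_for H p \<and> parseval_frame_for K q \<and>
    (\<forall>u w. (\<Sum>i\<in>UNIV. (u \<bullet> p i) * (w \<bullet> q i)) = 0)"
proof -
  have pH: "p i \<in> H" and qK: "q i \<in> K" for i
    using p q by auto
  have expand: "(\<Sum>i\<in>UNIV. ((u + w) \<bullet> (p i + q i))\<^sup>2) =
      (\<Sum>i\<in>UNIV. (u \<bullet> p i)\<^sup>2) + (\<Sum>i\<in>UNIV. (w \<bullet> q i)\<^sup>2) + 2 * (\<Sum>i\<in>UNIV. (u \<bullet> p i) * (w \<bullet> q i))"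
    if "u \<in> H" "w \<in> K" for u w
  proof -
    \<comment> \<open>The mixed products \<open>u \<bullet> q i\<close> and
      \<open>w \<bullet> p i\<close> vanish.\<close>
    have "(u + w) \<bullet> (p i + q i) = u \<bullet> p i + w \<bullet> q i" for i
      using orth[OF \<open>u \<in> H\<close> qK] orth[OF pH \<open>w \<in> K\<close>]
      by (simp add: inner_add inner_commute)
    then show ?thesis
      by (simp add: power2_sum sum.distrib sum_distrib_left mult.assoc)
  qed
  have pythagoras: "(norm (u + w))\<^sup>2 = (norm u)\<^sup>2 + (norm w)\<^sup>2" if "u \<in> H" "w \<in> K" for u w
    using orth[OF that] by (simp add: norm_add_Pythagorean orthogonal_def)
  show ?thesis
  proof (intro iffI conjI allI)
    assume "parseval_frame_for UNIV (\<lambda>i. p i + q i)"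
    then have parseval: "(\<Sum>i\<in>UNIV. (v \<bullet> (p i + q i))\<^sup>2) = (norm v)\<^sup>2" for v
      by (simp add: parseval_frame_for_def)
    have pv: "(\<Sum>i\<in>UNIV. (u \<bullet> p i)\<^sup>2) = (norm u)\<^sup>2" if "u \<in> H" for u
      using expand[OF that subspace_0[OF K]] parseval[of u] by simp
    have qv: "(\<Sum>i\<in>UNIV. (w \<bullet> q i)\<^sup>2) = (norm w)\<^sup>2" if "w \<in> K" for w
      using expand[OF subspace_0[OF H] that] parseval[of w] by simp
    show "parseval_frame_for H p" "parseval_frame_for K q"
      using H K p q pv qv by (simp_all add: parseval_frame_for_def)
    fix u w
    obtain u1 w1 where u: "u = u1 + w1" "u1 \<in> H" "w1 \<in> K"
      using decomp by blast
    obtain u2 w2 where w: "w = u2 + w2" "u2 \<in> H" "w2 \<in> K"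
      using decomp by blast
    \<comment> \<open>Each \<open>p i\<close> sees only the \<open>H\<close> component of
      \<open>u\<close>, each \<open>q i\<close> only the \<open>K\<close> component of
      \<open>w\<close>. So the Parseval identity at the hybrid vector \<open>u1 + w2\<close>
      controls the cross term: after cancelling the squared norms, twice this term remains and must
      be 0.\<close>
    have "u \<bullet> p i = u1 \<bullet> p i" "w \<bullet> q i = w2 \<bullet> q i" for i
      using u w orth[OF pH, of w1] orth[OF _ qK, of u2]
      by (simp_all add: inner_add_left inner_commute[of w1])
    then show "(\<Sum>i\<in>UNIV. (u \<bullet> p i) * (w \<bullet> q i)) = 0"
      using expand[of u1 w2] parseval[of "u1 + w2"] pythagoras[of u1 w2] pv[of u1] qv[of w2] u w
      by simp
  next
    assume *: "parseval_frame_for H p \<and> parseval_frame_for K q \<and>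
      (\<forall>u w. (\<Sum>i\<in>UNIV. (u \<bullet> p i) * (w \<bullet> q i)) = 0)"
    have "(\<Sum>i\<in>UNIV. (v \<bullet> (p i + q i))\<^sup>2) = (norm v)\<^sup>2" for v
    proof -
      obtain u w where "v = u + w" "u \<in> H" "w \<in> K"
        using decomp by blast
      with * show ?thesis
        by (simp add: parseval_frame_for_def expand pythagoras)
    qed
    then show "parseval_frame_for UNIV (\<lambda>i. p i + q i)"
      by (simp add: parseval_frame_for_def)
  qed
qed

text \<open>The inner products of the rows are the entries of the matrix representing the bilinear
  form on the right, and a bilinear form is zero exactly when its matrix is.\<close>

lemma orthogonal_rows_matrix_of_columns_iff:
  fixes p q :: "'m::finite \<Rightarrow> real ^ 'n::finite"
  shows "(\<forall>k l. orthogonal (row k (matrix_of_columns p)) (row l (matrix_of_columns q))) \<longleftrightarrow>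
    (\<forall>u w. (\<Sum>i\<in>UNIV. (u \<bullet> p i) * (w \<bullet> q i)) = 0)"
proof -
  have entry: "row k (matrix_of_columns p) \<bullet> row l (matrix_of_columns q) =
      (\<Sum>i\<in>UNIV. p i $ k * q i $ l)" for k l
    by (simp add: inner_vec_def row_def matrix_of_columns_def)
  have bilinear: "(\<Sum>i\<in>UNIV. (u \<bullet> p i) * (w \<bullet> q i)) =
      (\<Sum>k\<in>UNIV. \<Sum>l\<in>UNIV. u $ k * w $ l * (\<Sum>i\<in>UNIV. p i $ k * q i $ l))" for u w
  proof -
    have "(\<Sum>i\<in>UNIV. (u \<bullet> p i) * (w \<bullet> q i)) =
        (\<Sum>i\<in>UNIV. \<Sum>k\<in>UNIV. \<Sum>l\<in>UNIV. u $ k * w $ l * (p i $ k * q i $ l))"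
      by (simp add: inner_vec_def sum_product mult_ac)
    also have "\<dots> = (\<Sum>k\<in>UNIV. \<Sum>i\<in>UNIV. \<Sum>l\<in>UNIV. u $ k * w $ l * (p i $ k * q i $ l))"
      by (rule sum.swap)
    also have "\<dots> = (\<Sum>k\<in>UNIV. \<Sum>l\<in>UNIV. \<Sum>i\<in>UNIV. u $ k * w $ l * (p i $ k * q i $ l))"
      by (intro sum.cong refl sum.swap)
    finally show ?thesis
      by (simp add: sum_distrib_left)
  qed
  show ?thesis
  proof
    assume "\<forall>k l. orthogonal (row k (matrix_of_columns p)) (row l (matrix_of_columns q))"
    then show "\<forall>u w. (\<Sum>i\<in>UNIV. (u \<bullet> p i) * (w \<bullet> q i)) = 0"
      by (simp add: orthogonal_def entry bilinear)
  next
    assume *: "\<forall>u w. (\<Sum>i\<in>UNIV. (u \<bullet> p i) * (w \<bullet> q i)) = 0"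
    have "(\<Sum>i\<in>UNIV. p i $ k * q i $ l) = 0" for k l
      \<comment> \<open>Canonical basis vectors pick out entry \<open>(k, l)\<close> of that
        matrix.\<close>
      using *[rule_format, of "axis k 1" "axis l 1"] by (simp add: inner_axis')
    then show "\<forall>k l. orthogonal (row k (matrix_of_columns p)) (row l (matrix_of_columns q))"
      by (simp add: orthogonal_def entry)
  qed
qed

theorem corollary2p9:
  fixes x :: "'m::finite \<Rightarrow> real ^ 'n::finite"
    and P :: "real ^ 'n \<Rightarrow> real ^ 'n"
    and a b :: "'m \<Rightarrow> real"
  assumes "frame_for UNIV x"
    and "orthogonal_projection P"
  shows "piecewise_scalable_with x P a b \<longleftrightarrow>
    parseval_frame_for (range P) (\<lambda>i. a i *\<^sub>R P (x i)) \<and>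
    parseval_frame_for (range (\<lambda>v. v - P v)) (\<lambda>i. b i *\<^sub>R (x i - P (x i))) \<and>
    (\<forall>k l. orthogonal (row k (matrix_of_columns (\<lambda>i. a i *\<^sub>R P (x i))))
                      (row l (matrix_of_columns (\<lambda>i. b i *\<^sub>R (x i - P (x i))))))"
proof -
  let ?H = "range P" and ?K = "range (\<lambda>v. v - P v)"
  have lin: "linear P"
    using assms(2) by (simp add: orthogonal_projection_def)
  have H: "subspace ?H" and K: "subspace ?K"
    using lin by (auto intro!: linear_subspace_image linear_compose_sub linear_ident)
  have "a i *\<^sub>R P (x i) \<in> ?H" "b i *\<^sub>R (x i - P (x i)) \<in> ?K" for i
    by (auto intro: subspace_scale[OF H] subspace_scale[OF K])
  then have pq: "range (\<lambda>i. a i *\<^sub>R P (x i)) \<subseteq> ?H" "range (\<lambda>i. b i *\<^sub>R (x i - P (x i))) \<subseteq> ?K"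
    by blast+
  have decomp: "\<exists>u\<in>?H. \<exists>w\<in>?K. v = u + w" for v
    by (rule bexI[of _ "P v"], rule bexI[of _ "v - P v"]) auto
  have orth: "u \<bullet> w = 0" if "u \<in> ?H" "w \<in> ?K" for u w
    using that orthogonal_projection_inner_complement[OF assms(2)] by blast
  show ?thesis
    using assms parseval_frame_for_orthogonal_sum_iff[OF H K orth decomp pq]
    by (simp add: piecewise_scalable_with_def orthogonal_rows_matrix_of_columns_iff)
qed

end
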